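(* Let $S\subset\mathbb{R}^2$ be a compact set such that $\partial S$ is path-connected and $S=\overline{\mathrm{int}(S)}$. Assume that (a) for all $\theta\in[0,\pi/2]$ the limit $L_0(\theta)=\lim_{\epsilon\to0}\dfrac{\mu(B(\partial\mathbb{B}_\theta(S),\epsilon))}{2\epsilon}$ exists and is finite, and the convergence is uniform in $\theta$; (b) there exists $L>0$ such that $L_0(\theta)\leq L$ for all $\theta$. Let $\mathcal{X}_n=\{X_1,\dots,X_n\}$, where $X_1,X_2,\dots$ are independent and identically distributed with a distribution $P_X$ whose support is $S$. Let $A$ be the set of angles $\theta\in[0,\pi/2]$ for which $S$ is $\theta$-biconvex, and assume that $A$ is non-empty. For $\theta\in[0,\pi/2]$ define the random functions $\Psi_n(\theta)=\mu(\mathbb{B}_\theta(\mathcal{X}_n))$, and let $\{\hat\theta_n\}$ be a sequence of random variables such that $$\hat\theta_n\in\operatorname{argmin}_{\theta\in[0,\pi/2]}\Psi_n(\theta).$$ Then, with probability one, all the accumulation points of the sequence $\{\hat\theta_n\}$ belong to $A$.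
   Context: $\mathbb{R}^2$ carries the Euclidean norm $\|\cdot\|$ and inner product $\langle\cdot,\cdot\rangle$; $\partial$, $\mathrm{int}$, overline and superscript $c$ denote boundary, interior, closure and complement; $\mu$ is Lebesgue measure on $\mathbb{R}^2$; $B(T,\epsilon)=\bigcup_{t\in T}B(t,\epsilon)$ is the union of closed balls of radius $\epsilon$ centred in $T$; the support of a distribution is the smallest closed set of probability one. For $\theta\in[0,\pi/2]$ put $b_1=(\cos\theta,\sin\theta)$, $b_2=(-\sin\theta,\cos\theta)$, $\xi=(b_1+b_2)/\|b_1+b_2\|$. A set $S$ is $\theta$-biconvex if for all $\alpha,\beta\in\mathbb{R}$ the sets $\{\alpha b_1+tb_2:t\in\mathbb{R}\}\cap S$ and $\{tb_1+\beta b_2:t\in\mathbb{R}\}\cap S$ are convex (possibly empty). Let $R$ be the counter-clockwise rotation of angle $\pi/2$ about the origin, $R^0(\xi)=\xi$, $R^i(\xi)=R(R^{i-1}(\xi))$. For a unit vector $v$ and $x\in\mathbb{R}^2$, $C_v(x)=\{z\neq x:\langle v,(z-x)/\|z-x\|\rangle>\cos(\pi/4)\}$ (open quadrant with vertex $x$ and axis $v$). The $\theta$-biconvex hull of $A'\subset\mathbb{R}^2$ is $$\mathbb{B}_\theta(A')=\bigcap\big\{(C_{R^i(\xi)}(y))^c:\ i\in\{0,1,2,3\},\ y\in\mathbb{R}^2,\ C_{R^i(\xi)}(y)\cap A'=\emptyset\big\}.$$ *)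

theory Defs
  imports "HOL-Probability.Probability"
begin

definition axis1 :: "real \<Rightarrow> real^2" where
  "axis1 \<theta> = vector [cos \<theta>, sin \<theta>]"

definition axis2 :: "real \<Rightarrow> real^2" where
  "axis2 \<theta> = vector [- sin \<theta>, cos \<theta>]"

definition diag_dir :: "real \<Rightarrow> real^2" where
  "diag_dir \<theta> = (axis1 \<theta> + axis2 \<theta>) /\<^sub>R norm (axis1 \<theta> + axis2 \<theta>)"

definition biconvex :: "real \<Rightarrow> (real^2) set \<Rightarrow> bool" where
  "biconvex \<theta> S \<longleftrightarrow>
     (\<forall>\<alpha> \<beta>. convex ({\<alpha> *\<^sub>R axis1 \<theta> + t *\<^sub>R axis2 \<theta> | t. t \<in> UNIV} \<inter> S) \<and>
            convex ({t *\<^sub>R axis1 \<theta> + \<beta> *\<^sub>R axis2 \<theta> | t. t \<in> UNIV} \<inter> S))"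

text \<open>Counter-clockwise rotation by a right angle about the origin.\<close>

definition rot90 :: "real^2 \<Rightarrow> real^2" where
  "rot90 x = vector [- (x $ 2), x $ 1]"

definition quadrant :: "real^2 \<Rightarrow> real^2 \<Rightarrow> (real^2) set" where
  "quadrant v x = {z. z \<noteq> x \<and> v \<bullet> ((z - x) /\<^sub>R norm (z - x)) > cos (pi / 4)}"

definition biconvex_hull :: "real \<Rightarrow> (real^2) set \<Rightarrow> (real^2) set" where
  "biconvex_hull \<theta> T =
     \<Inter>{- quadrant ((rot90 ^^ i) (diag_dir \<theta>)) y | i y.
         i \<in> {0, 1, 2, 3} \<and> quadrant ((rot90 ^^ i) (diag_dir \<theta>)) y \<inter> T = {}}"

definition closed_thickening :: "(real^2) set \<Rightarrow> real \<Rightarrow> (real^2) set" where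
  "closed_thickening T \<epsilon> = (\<Union>t\<in>T. cball t \<epsilon>)"

text \<open>\<open>S\<close> is the smallest closed set of probability one under \<open>P\<close>.\<close>

definition is_support :: "(real^2) measure \<Rightarrow> (real^2) set \<Rightarrow> bool" where
  "is_support P S \<longleftrightarrow>
     closed S \<and> measure P S = 1 \<and> (\<forall>T. closed T \<and> measure P T = 1 \<longrightarrow> S \<subseteq> T)"

text \<open>Accumulation points of a sequence are its subsequential limits; this differs from
  the limit points of the range, since a value attained infinitely often counts.\<close>

definition seq_accumulation_point :: "(nat \<Rightarrow> real) \<Rightarrow> real \<Rightarrow> bool" where
  "seq_accumulation_point u a \<longleftrightarrow> (\<exists>r. strict_mono r \<and> (u \<circ> r) \<longlonglongrightarrow> a)"

end

theory Submission imports Defs begin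

text \<open>
  Let \<open>H \<theta>\<close> be the hull of \<open>S\<close> and \<open>a\<close> the limit of a subsequence of minimisers.
  If \<open>x\<close> is interior to \<open>H a\<close>, each open quadrant with vertex \<open>x\<close> meets \<open>S\<close>, hence contains a sample
  point almost surely, and by continuity the same sample point works for all nearby angles. So \<open>x\<close>
  eventually lies in the sample hulls, whose areas are at most \<open>\<mu>(S)\<close> by comparison with a good
  angle, at which \<open>H\<close> is \<open>S\<close> because \<open>S\<close> is connected. Hence \<open>\<mu>(int (H a)) \<le> \<mu>(S)\<close>; existence of
  \<open>L0 a\<close> makes the frontier of \<open>H a\<close> null, so \<open>H a - S\<close> is null. For connected \<open>S\<close>
  this forces \<open>S\<close> to be biconvex at \<open>a\<close>.
\<close>

section \<open>Quadrants and the hull in coordinates of the rotated frame\<close>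

text \<open>For signs \<open>s\<close>, \<open>t\<close> in \<open>{-1, 1}\<close> these are the
  four open quadrants with vertex \<open>y\<close>. Two linear inequalities replace the cosine, so
  that openness, inclusions and dependence on the angle become elementary.\<close>

definition frame_quadrant :: "real \<Rightarrow> real \<Rightarrow> real \<Rightarrow> real^2 \<Rightarrow> (real^2) set" where
  "frame_quadrant \<theta> s t y =
     {z. s * (axis1 \<theta> \<bullet> (z - y)) > 0 \<and> t * (axis2 \<theta> \<bullet> (z - y)) > 0}"

text \<open>Centred at the point to be captured, with signed offsets to either side, because later
  arguments start from a point \<open>x\<close> and look both ways along its line.\<close>

definition convex_along :: "real^2 \<Rightarrow> (real^2) set \<Rightarrow> bool" where
  "convex_along e T \<longleftrightarrow>
     (\<forall>x a b. a \<le> 0 \<longrightarrow> 0 \<le> b \<longrightarrow> x + a *\<^sub>R e \<in> T \<longrightarrow> x + b *\<^sub>R e \<in> T \<longrightarrow> x \<in> T)"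

lemma axis_inner [simp]:
  "axis1 \<theta> \<bullet> axis1 \<theta> = 1" "axis2 \<theta> \<bullet> axis2 \<theta> = 1"
  "axis1 \<theta> \<bullet> axis2 \<theta> = 0" "axis2 \<theta> \<bullet> axis1 \<theta> = 0"
  by (simp_all add: axis1_def axis2_def inner_vec_def sum_2 flip: power2_eq_square)

lemma axis_expansion: "x = (axis1 \<theta> \<bullet> x) *\<^sub>R axis1 \<theta> + (axis2 \<theta> \<bullet> x) *\<^sub>R axis2 \<theta>"
proof -
  have e: "x1 = (c * x1 + s * x2) * c + (- s * x1 + c * x2) * (- s)"
      "x2 = (c * x1 + s * x2) * s + (- s * x1 + c * x2) * c"
    if "c * c + s * s = 1" for c s x1 x2 :: real
    using that by algebra+
  have "cos \<theta> * cos \<theta> + sin \<theta> * sin \<theta> = 1"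
    by (simp flip: power2_eq_square)
  from e[OF this, of "x $ 1" "x $ 2"] e[OF this, of "x $ 2" "x $ 1"] show ?thesis
    unfolding vec_eq_iff forall_2 axis1_def axis2_def inner_vec_def sum_2 by simp
qed

lemma norm_axis_expansion: "(norm x)\<^sup>2 = (axis1 \<theta> \<bullet> x)\<^sup>2 + (axis2 \<theta> \<bullet> x)\<^sup>2"
proof -
  have "x \<bullet> x = x \<bullet> ((axis1 \<theta> \<bullet> x) *\<^sub>R axis1 \<theta> + (axis2 \<theta> \<bullet> x) *\<^sub>R axis2 \<theta>)"
    using axis_expansion[of x \<theta>] by simp
  then show ?thesis
    by (simp add: inner_add_right inner_commute power2_norm_eq_inner power2_eq_square[of "_ \<bullet> _"])
qed

text \<open>The squares of the two sides differ by \<open>2 * p * q\<close>, which is positive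
  together with \<open>p + q\<close> only if both numbers are. For the coordinates \<open>p\<close>,
  \<open>q\<close> of a vector, this decides when its angle to the diagonal is below 45
  degrees.\<close>

lemma sum_gt_sqrt_sum_squares_iff:
  fixes p q :: real
  shows "p + q > sqrt (p\<^sup>2 + q\<^sup>2) \<longleftrightarrow> p > 0 \<and> q > 0"
proof
  assume l: "p + q > sqrt (p\<^sup>2 + q\<^sup>2)"
  have pos: "p + q > 0"
    using l real_sqrt_ge_zero[of "p\<^sup>2 + q\<^sup>2"] by (smt (verit) zero_le_power2)
  have "p\<^sup>2 + q\<^sup>2 < (p + q)\<^sup>2"
    using l pos by (metis less_eq_real_def not_less real_sqrt_le_mono real_sqrt_unique)
  then have "p * q > 0" by (simp add: power2_sum)
  then show "p > 0 \<and> q > 0" using pos by (auto simp: zero_less_mult_iff)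
next
  assume "p > 0 \<and> q > 0"
  then have "p\<^sup>2 + q\<^sup>2 < (p + q)\<^sup>2" by (simp add: power2_sum)
  then show "p + q > sqrt (p\<^sup>2 + q\<^sup>2)"
    using \<open>p > 0 \<and> q > 0\<close> by (simp add: real_less_lsqrt)
qed

lemma diag_dir_eq: "diag_dir \<theta> = (1 / sqrt 2) *\<^sub>R (axis1 \<theta> + axis2 \<theta>)"
proof -
  have "norm (axis1 \<theta> + axis2 \<theta>) = sqrt 2"
    by (simp add: norm_eq_sqrt_inner inner_add_left inner_add_right)
  then show ?thesis by (simp add: diag_dir_def inverse_eq_divide)
qed

lemma rot90_axes:
  "rot90 (c *\<^sub>R (a *\<^sub>R axis1 \<theta> + b *\<^sub>R axis2 \<theta>)) = c *\<^sub>R ((- b) *\<^sub>R axis1 \<theta> + a *\<^sub>R axis2 \<theta>)"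
  by (simp add: rot90_def axis1_def axis2_def vec_eq_iff forall_2 algebra_simps)

text \<open>The inner product of the unit diagonal with the direction of \<open>z - y\<close> is
  \<open>(p + q) / (sqrt 2 * norm (z - y))\<close> for the signed coordinates \<open>p\<close>,
  \<open>q\<close>, so exceeding \<open>cos (pi / 4)\<close> means that \<open>p + q\<close> exceeds
  the norm.\<close>

lemma quadrant_axes:
  assumes "s \<in> {-1, 1}" "t \<in> {-1, 1}"
  shows "quadrant ((1 / sqrt 2) *\<^sub>R (s *\<^sub>R axis1 \<theta> + t *\<^sub>R axis2 \<theta>)) y = frame_quadrant \<theta> s t y"
proof -
  have "z \<in> quadrant ((1 / sqrt 2) *\<^sub>R (s *\<^sub>R axis1 \<theta> + t *\<^sub>R axis2 \<theta>)) y
      \<longleftrightarrow> z \<in> frame_quadrant \<theta> s t y" for z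
  proof (cases "z = y")
    case True
    then show ?thesis by (simp add: quadrant_def frame_quadrant_def)
  next
    case False
    define p where "p = s * (axis1 \<theta> \<bullet> (z - y))"
    define q where "q = t * (axis2 \<theta> \<bullet> (z - y))"
    have n: "norm (z - y) > 0" using False by simp
    have "(norm (z - y))\<^sup>2 = p\<^sup>2 + q\<^sup>2"
      using assms by (auto simp: norm_axis_expansion[of _ \<theta>] p_def q_def power_mult_distrib)
    then have nn: "norm (z - y) = sqrt (p\<^sup>2 + q\<^sup>2)"
      by (metis norm_ge_zero real_sqrt_unique)
    have "((1 / sqrt 2) *\<^sub>R (s *\<^sub>R axis1 \<theta> + t *\<^sub>R axis2 \<theta>)) \<bullet> ((z - y) /\<^sub>R norm (z - y))
        = (1 / sqrt 2) * ((p + q) / norm (z - y))"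
      by (simp add: p_def q_def inner_add_left divide_inverse mult_ac)
    moreover have "cos (pi / 4) = 1 / sqrt 2" by (simp add: cos_45 real_div_sqrt field_simps)
    ultimately have "z \<in> quadrant ((1 / sqrt 2) *\<^sub>R (s *\<^sub>R axis1 \<theta> + t *\<^sub>R axis2 \<theta>)) y
       \<longleftrightarrow> 1 / sqrt 2 < (1 / sqrt 2) * ((p + q) / norm (z - y))"
      using False by (simp add: quadrant_def)
    also have "\<dots> \<longleftrightarrow> norm (z - y) < p + q"
      using n by (simp add: field_simps)
    also have "\<dots> \<longleftrightarrow> p > 0 \<and> q > 0" by (simp only: nn sum_gt_sqrt_sum_squares_iff)
    finally show ?thesis by (simp add: frame_quadrant_def p_def q_def)
  qed
  then show ?thesis by blast
qed

lemma quadrant_rot90: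
  "quadrant ((rot90 ^^ 0) (diag_dir \<theta>)) = frame_quadrant \<theta> 1 1"
  "quadrant ((rot90 ^^ 1) (diag_dir \<theta>)) = frame_quadrant \<theta> (-1) 1"
  "quadrant ((rot90 ^^ 2) (diag_dir \<theta>)) = frame_quadrant \<theta> (-1) (-1)"
  "quadrant ((rot90 ^^ 3) (diag_dir \<theta>)) = frame_quadrant \<theta> 1 (-1)"
proof -
  have 0: "(rot90 ^^ 0) (diag_dir \<theta>) = (1 / sqrt 2) *\<^sub>R (1 *\<^sub>R axis1 \<theta> + 1 *\<^sub>R axis2 \<theta>)"
    by (simp add: diag_dir_eq)
  have 1: "(rot90 ^^ 1) (diag_dir \<theta>) = (1 / sqrt 2) *\<^sub>R ((-1) *\<^sub>R axis1 \<theta> + 1 *\<^sub>R axis2 \<theta>)"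
    using 0 rot90_axes[of "1 / sqrt 2" 1 \<theta> 1] by simp
  have 2: "(rot90 ^^ 2) (diag_dir \<theta>) = (1 / sqrt 2) *\<^sub>R ((-1) *\<^sub>R axis1 \<theta> + (-1) *\<^sub>R axis2 \<theta>)"
    using 1 rot90_axes[of "1 / sqrt 2" "-1" \<theta> 1] by (simp add: numeral_2_eq_2)
  have 3: "(rot90 ^^ 3) (diag_dir \<theta>) = (1 / sqrt 2) *\<^sub>R (1 *\<^sub>R axis1 \<theta> + (-1) *\<^sub>R axis2 \<theta>)"
    using 2 rot90_axes[of "1 / sqrt 2" "-1" \<theta> "-1"] by (simp add: numeral_2_eq_2 numeral_3_eq_3)
  show "quadrant ((rot90 ^^ 0) (diag_dir \<theta>)) = frame_quadrant \<theta> 1 1"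
    unfolding 0 by (rule ext) (rule quadrant_axes; simp)
  show "quadrant ((rot90 ^^ 1) (diag_dir \<theta>)) = frame_quadrant \<theta> (-1) 1"
    unfolding 1 by (rule ext) (rule quadrant_axes; simp)
  show "quadrant ((rot90 ^^ 2) (diag_dir \<theta>)) = frame_quadrant \<theta> (-1) (-1)"
    unfolding 2 by (rule ext) (rule quadrant_axes; simp)
  show "quadrant ((rot90 ^^ 3) (diag_dir \<theta>)) = frame_quadrant \<theta> 1 (-1)"
    unfolding 3 by (rule ext) (rule quadrant_axes; simp)
qed

lemma biconvex_hull_eq:
  "biconvex_hull \<theta> T =
     \<Inter>{- frame_quadrant \<theta> s t y | s t y.
        s \<in> {-1, 1} \<and> t \<in> {-1, 1} \<and> frame_quadrant \<theta> s t y \<inter> T = {}}" (is "_ = \<Inter>?R")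
proof -
  have "{- quadrant ((rot90 ^^ i) (diag_dir \<theta>)) y | i y.
      i \<in> {0, 1, 2, 3} \<and> quadrant ((rot90 ^^ i) (diag_dir \<theta>)) y \<inter> T = {}} = ?R" (is "?L = _")
  proof (intro equalityI subsetI)
    fix Z assume "Z \<in> ?L"
    then obtain i y where Z: "Z = - quadrant ((rot90 ^^ i) (diag_dir \<theta>)) y"
      and e: "quadrant ((rot90 ^^ i) (diag_dir \<theta>)) y \<inter> T = {}" and i: "i \<in> {0, 1, 2, 3}"
      by blast
    obtain s t where "s \<in> {-1, 1}" "t \<in> {-1, 1}"
        "quadrant ((rot90 ^^ i) (diag_dir \<theta>)) = frame_quadrant \<theta> s t"
      using i quadrant_rot90[of \<theta>]
      by (metis insertE insertI1 insert_commute singletonD)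
    then show "Z \<in> ?R" using Z e
      by (intro CollectI exI[of _ s] exI[of _ t] exI[of _ y] conjI) (simp_all only:)
  next
    fix Z assume "Z \<in> ?R"
    then obtain s t y where Z: "Z = - frame_quadrant \<theta> s t y"
      and e: "frame_quadrant \<theta> s t y \<inter> T = {}" and st: "s \<in> {-1, 1}" "t \<in> {-1, 1}"
      by blast
    obtain i where "i \<in> {0, 1, 2, 3}"
        "quadrant ((rot90 ^^ i) (diag_dir \<theta>)) = frame_quadrant \<theta> s t"
      using st quadrant_rot90[of \<theta>]
      by (metis insertE insertI1 insert_commute singletonD)
    then show "Z \<in> ?L" using Z e
      by (intro CollectI exI[of _ i] exI[of _ y] conjI) (simp_all only:)
  qed
  then show ?thesis by (simp only: biconvex_hull_def)
qed

lemma mem_biconvex_hull: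
  "x \<in> biconvex_hull \<theta> T \<longleftrightarrow>
     (\<forall>s\<in>{-1, 1}. \<forall>t\<in>{-1, 1}. \<forall>y. x \<in> frame_quadrant \<theta> s t y
        \<longrightarrow> frame_quadrant \<theta> s t y \<inter> T \<noteq> {})"
  unfolding biconvex_hull_eq by blast

lemma open_frame_quadrant: "open (frame_quadrant \<theta> s t y)"
  unfolding frame_quadrant_def
  by (intro open_Collect_conj open_Collect_less continuous_intros)

lemma closed_biconvex_hull: "closed (biconvex_hull \<theta> T)"
  unfolding biconvex_hull_eq
  by (intro closed_Inter) (auto simp: open_frame_quadrant closed_Compl)

lemma subset_biconvex_hull: "T \<subseteq> biconvex_hull \<theta> T"
  by (auto simp: mem_biconvex_hull)

lemma biconvex_hull_mono: "T \<subseteq> T' \<Longrightarrow> biconvex_hull \<theta> T \<subseteq> biconvex_hull \<theta> T'"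
  unfolding subset_iff mem_biconvex_hull by blast

section \<open>Biconvexity as convexity along the two axes\<close>

text \<open>The spanning assumption places any \<open>x\<close> on one of the lines, where
  \<open>x\<close> is the combination of the two given points with weights
  \<open>b / (b - a)\<close> and \<open>- a / (b - a)\<close>. Conversely, a convex combination of
  two points sees them at offsets on either side.\<close>

lemma convex_along_iff_convex_lines:
  fixes d e :: "real^2"
  assumes "\<And>x. \<exists>\<alpha> t. x = \<alpha> *\<^sub>R d + t *\<^sub>R e"
  shows "(\<forall>\<alpha>. convex ({\<alpha> *\<^sub>R d + t *\<^sub>R e | t. t \<in> UNIV} \<inter> T)) \<longleftrightarrow> convex_along e T"
proof
  assume c: "\<forall>\<alpha>. convex ({\<alpha> *\<^sub>R d + t *\<^sub>R e | t. t \<in> UNIV} \<inter> T)"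
  show "convex_along e T"
    unfolding convex_along_def
  proof (intro allI impI)
    fix x a b
    assume ab: "a \<le> 0" "0 \<le> b" and m: "x + a *\<^sub>R e \<in> T" "x + b *\<^sub>R e \<in> T"
    show "x \<in> T"
    proof (cases "a = b")
      case True
      then show ?thesis using ab m by simp
    next
      case False
      then have pos: "b - a > 0" using ab by simp
      obtain \<alpha> t where x: "x = \<alpha> *\<^sub>R d + t *\<^sub>R e" using assms by blast
      let ?L = "{\<alpha> *\<^sub>R d + t *\<^sub>R e | t. t \<in> UNIV} \<inter> T"
      have "x + c *\<^sub>R e = \<alpha> *\<^sub>R d + (t + c) *\<^sub>R e" for c by (simp add: x algebra_simps)
      then have mm: "x + a *\<^sub>R e \<in> ?L" "x + b *\<^sub>R e \<in> ?L" using m by blast+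
      have coeff: "b / (b - a) + - a / (b - a) = 1"
        using pos by (simp flip: diff_divide_distrib)
      have "(b / (b - a)) *\<^sub>R (x + a *\<^sub>R e) + (- a / (b - a)) *\<^sub>R (x + b *\<^sub>R e) \<in> ?L"
        by (rule convexD[OF c[rule_format] mm])
          (use ab pos coeff in \<open>auto simp: divide_nonpos_pos\<close>)
      also have "(b / (b - a)) *\<^sub>R (x + a *\<^sub>R e) + (- a / (b - a)) *\<^sub>R (x + b *\<^sub>R e)
          = (b / (b - a) + - a / (b - a)) *\<^sub>R x + (b / (b - a) * a + - a / (b - a) * b) *\<^sub>R e"
        by (simp only: scaleR_add_right scaleR_add_left scaleR_scaleR ac_simps)
      also have "\<dots> = x" by (simp only: coeff) simp
      finally show ?thesis by simp
    qed
  qed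
next
  assume c: "convex_along e T"
  show "\<forall>\<alpha>. convex ({\<alpha> *\<^sub>R d + t *\<^sub>R e | t. t \<in> UNIV} \<inter> T)"
  proof (intro allI convexI)
    fix \<alpha> p q u v
    assume p: "p \<in> {\<alpha> *\<^sub>R d + t *\<^sub>R e | t. t \<in> UNIV} \<inter> T"
      and q: "q \<in> {\<alpha> *\<^sub>R d + t *\<^sub>R e | t. t \<in> UNIV} \<inter> T"
      and uv: "0 \<le> u" "0 \<le> v" "u + v = (1::real)"
    obtain a b where a: "p = \<alpha> *\<^sub>R d + a *\<^sub>R e" and b: "q = \<alpha> *\<^sub>R d + b *\<^sub>R e"
      using p q by auto
    have u: "u = 1 - v" using uv by simp
    let ?x = "u *\<^sub>R p + v *\<^sub>R q"
    have x: "?x = \<alpha> *\<^sub>R d + (a + v * (b - a)) *\<^sub>R e" by (simp add: a b u algebra_simps)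
    have 1: "p = ?x + (- v * (b - a)) *\<^sub>R e" "q = ?x + ((1 - v) * (b - a)) *\<^sub>R e"
      unfolding x by (simp_all add: a b algebra_simps)
    have "?x \<in> T"
    proof (cases "a \<le> b")
      case True
      then show ?thesis
        using c[unfolded convex_along_def, rule_format,
            of "- v * (b - a)" "(1 - v) * (b - a)" ?x] 1 p q uv
        by auto
    next
      case False
      then show ?thesis
        using c[unfolded convex_along_def, rule_format,
            of "(1 - v) * (b - a)" "- v * (b - a)" ?x] 1 p q uv
        by (auto simp: mult_nonneg_nonpos mult_le_0_iff)
    qed
    then show "?x \<in> {\<alpha> *\<^sub>R d + t *\<^sub>R e | t. t \<in> UNIV} \<inter> T" using x by blast
  qed
qed

lemma biconvex_iff: "biconvex \<theta> T \<longleftrightarrow> convex_along (axis1 \<theta>) T \<and> convex_along (axis2 \<theta>) T"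
proof -
  have 2: "(\<forall>\<alpha>. convex ({\<alpha> *\<^sub>R axis1 \<theta> + t *\<^sub>R axis2 \<theta> | t. t \<in> UNIV} \<inter> T))
      \<longleftrightarrow> convex_along (axis2 \<theta>) T"
    using axis_expansion[of _ \<theta>] by (intro convex_along_iff_convex_lines) blast
  have "\<exists>\<alpha> t. x = \<alpha> *\<^sub>R axis2 \<theta> + t *\<^sub>R axis1 \<theta>" for x
    using axis_expansion[of x \<theta>] by (metis add.commute)
  then have 1: "(\<forall>\<alpha>. convex ({\<alpha> *\<^sub>R axis2 \<theta> + t *\<^sub>R axis1 \<theta> | t. t \<in> UNIV} \<inter> T))
      \<longleftrightarrow> convex_along (axis1 \<theta>) T"
    by (intro convex_along_iff_convex_lines) 
  show ?thesis using 1 2 by (auto simp: biconvex_def add.commute)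
qed

text \<open>Moving a point of a quadrant parallel to one axis keeps the other coordinate, and one of
  two opposite moves does not decrease the signed coordinate. So a quadrant containing
  \<open>x\<close> contains one of the two given hull points and hence meets
  \<open>T\<close>.\<close>

lemma biconvex_biconvex_hull: "biconvex \<theta> (biconvex_hull \<theta> T)"
proof -
  have sgn: "s * (c + a) > 0 \<or> s * (c + b) > 0" if "s * c > 0" "a \<le> 0" "0 \<le> b" "s \<in> {-1, 1}"
    for s c a b :: real
    using that by auto
  have "convex_along (axis1 \<theta>) (biconvex_hull \<theta> T)"
    unfolding convex_along_def
  proof (intro allI impI)
    fix x a b
    assume ab: "a \<le> 0" "0 \<le> b"
      and m: "x + a *\<^sub>R axis1 \<theta> \<in> biconvex_hull \<theta> T" "x + b *\<^sub>R axis1 \<theta> \<in> biconvex_hull \<theta> T"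
    show "x \<in> biconvex_hull \<theta> T"
      unfolding mem_biconvex_hull
    proof (intro ballI allI impI)
      fix s t y
      assume st: "s \<in> {-1, 1}" "t \<in> {-1, 1}" and x: "x \<in> frame_quadrant \<theta> s t y"
      have "x + a *\<^sub>R axis1 \<theta> \<in> frame_quadrant \<theta> s t y \<or> x + b *\<^sub>R axis1 \<theta> \<in> frame_quadrant \<theta> s t y"
        using x sgn[of s "axis1 \<theta> \<bullet> (x - y)" a b] ab st(1)
        by (simp add: frame_quadrant_def algebra_simps)
      then show "frame_quadrant \<theta> s t y \<inter> T \<noteq> {}"
        using m st unfolding mem_biconvex_hull by blast
    qed
  qed
  moreover have "convex_along (axis2 \<theta>) (biconvex_hull \<theta> T)"
    unfolding convex_along_def
  proof (intro allI impI)
    fix x a b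
    assume ab: "a \<le> 0" "0 \<le> b"
      and m: "x + a *\<^sub>R axis2 \<theta> \<in> biconvex_hull \<theta> T" "x + b *\<^sub>R axis2 \<theta> \<in> biconvex_hull \<theta> T"
    show "x \<in> biconvex_hull \<theta> T"
      unfolding mem_biconvex_hull
    proof (intro ballI allI impI)
      fix s t y
      assume st: "s \<in> {-1, 1}" "t \<in> {-1, 1}" and x: "x \<in> frame_quadrant \<theta> s t y"
      have "x + a *\<^sub>R axis2 \<theta> \<in> frame_quadrant \<theta> s t y \<or> x + b *\<^sub>R axis2 \<theta> \<in> frame_quadrant \<theta> s t y"
        using x sgn[of t "axis2 \<theta> \<bullet> (x - y)" a b] ab st(2)
        by (simp add: frame_quadrant_def algebra_simps)
      then show "frame_quadrant \<theta> s t y \<inter> T \<noteq> {}"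
        using m st unfolding mem_biconvex_hull by blast
    qed
  qed
  ultimately show ?thesis by (simp add: biconvex_iff)
qed

section \<open>Hulls of compact sets\<close>

text \<open>The assumption says that \<open>T\<close> misses the closed quadrant with vertex
  \<open>x\<close>. By compactness it does so with a margin \<open>\<delta>\<close>, so the vertex
  can be pulled back to give an open quadrant that contains \<open>x\<close> and still misses
  \<open>T\<close>.\<close>

lemma notin_biconvex_hullI:
  assumes "compact T" and st: "s \<in> {-1, 1}" "t \<in> {-1, 1}"
    and "\<And>z. z \<in> T \<Longrightarrow> s * (axis1 \<theta> \<bullet> (z - x)) < 0 \<or> t * (axis2 \<theta> \<bullet> (z - x)) < 0"
  shows "x \<notin> biconvex_hull \<theta> T"
proof -
  let ?h = "\<lambda>z. min (s * (axis1 \<theta> \<bullet> (z - x))) (t * (axis2 \<theta> \<bullet> (z - x)))"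
  have "\<exists>\<delta>>0. \<forall>z\<in>T. ?h z \<le> - \<delta>"
  proof (cases "T = {}")
    case True
    then show ?thesis by (auto intro: exI[of _ 1])
  next
    case False
    have "continuous_on T ?h" by (intro continuous_intros)
    then obtain z0 where "z0 \<in> T" "\<forall>z\<in>T. ?h z \<le> ?h z0"
      using continuous_attains_sup[OF assms(1) False] by blast
    then show ?thesis using assms(4)[of z0] by (intro exI[of _ "- ?h z0"]) auto
  qed
  then obtain \<delta> where \<delta>: "\<delta> > 0" "\<And>z. z \<in> T \<Longrightarrow> ?h z \<le> - \<delta>" by blast
  \<comment> \<open>Retreating by \<open>\<delta>\<close> along both signed axes raises each signed
    coordinate by exactly \<open>\<delta>\<close>, since \<open>s * s = t * t = 1\<close>.\<close>
  define y where "y = x - \<delta> *\<^sub>R (s *\<^sub>R axis1 \<theta> + t *\<^sub>R axis2 \<theta>)"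
  have sq: "s * s = 1" "t * t = 1" using st by auto
  have q: "z \<in> frame_quadrant \<theta> s t y \<longleftrightarrow> ?h z > - \<delta>" for z
  proof -
    have "s * (axis1 \<theta> \<bullet> (z - y)) = s * (axis1 \<theta> \<bullet> (z - x)) + \<delta> * (s * s)"
      "t * (axis2 \<theta> \<bullet> (z - y)) = t * (axis2 \<theta> \<bullet> (z - x)) + \<delta> * (t * t)"
      by (simp_all add: y_def algebra_simps)
    then show ?thesis by (auto simp: frame_quadrant_def sq)
  qed
  have "x \<in> frame_quadrant \<theta> s t y" using \<delta>(1) by (simp add: q)
  moreover have "frame_quadrant \<theta> s t y \<inter> T = {}" using \<delta>(2) by (force simp: q)
  ultimately show ?thesis using st unfolding mem_biconvex_hull by blast
qed

text \<open>A point with a coordinate larger than \<open>r\<close> in absolute value has a quadrant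
  pointing away from the origin that misses \<open>T\<close>. Bounds on both coordinates then bound
  the norm.\<close>

lemma compact_biconvex_hull:
  assumes "compact T"
  shows "compact (biconvex_hull \<theta> T)"
proof -
  obtain r where r: "\<And>z. z \<in> T \<Longrightarrow> norm z \<le> r"
    using compact_imp_bounded[OF assms] by (auto simp: bounded_iff)
  have le: "\<bar>e \<bullet> z\<bar> \<le> r" if "z \<in> T" "e \<bullet> e = 1" for e z
    using Cauchy_Schwarz_ineq2[of e z] r[OF that(1)] that(2) by (simp add: norm_eq_sqrt_inner)
  have "norm x \<le> r + r" if x: "x \<in> biconvex_hull \<theta> T" for x
  proof -
    have 1: "\<bar>axis1 \<theta> \<bullet> x\<bar> \<le> r"
    proof (rule ccontr)
      assume *: "\<not> \<bar>axis1 \<theta> \<bullet> x\<bar> \<le> r"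
      have "x \<notin> biconvex_hull \<theta> T"
      \<comment> \<open>The first sign points away from the origin, so the first disjunct holds on
        all of \<open>T\<close>; the second sign is an arbitrary choice.\<close>
      proof (rule notin_biconvex_hullI[OF assms, of "if axis1 \<theta> \<bullet> x > 0 then 1 else -1" 1])
        fix z assume "z \<in> T"
        from le[OF this, of "axis1 \<theta>"] *
        show "(if axis1 \<theta> \<bullet> x > 0 then 1 else -1) * (axis1 \<theta> \<bullet> (z - x)) < 0
            \<or> 1 * (axis2 \<theta> \<bullet> (z - x)) < 0"
          by (auto simp: inner_diff_right)
      qed auto
      then show False using x by simp
    qed
    have 2: "\<bar>axis2 \<theta> \<bullet> x\<bar> \<le> r"
    proof (rule ccontr)
      assume *: "\<not> \<bar>axis2 \<theta> \<bullet> x\<bar> \<le> r"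
      have "x \<notin> biconvex_hull \<theta> T"
      proof (rule notin_biconvex_hullI[OF assms, of 1 "if axis2 \<theta> \<bullet> x > 0 then 1 else -1"])
        fix z assume "z \<in> T"
        from le[OF this, of "axis2 \<theta>"] *
        show "1 * (axis1 \<theta> \<bullet> (z - x)) < 0
            \<or> (if axis2 \<theta> \<bullet> x > 0 then 1 else -1) * (axis2 \<theta> \<bullet> (z - x)) < 0"
          by (auto simp: inner_diff_right)
      qed auto
      then show False using x by simp
    qed
    have "norm x \<le> norm ((axis1 \<theta> \<bullet> x) *\<^sub>R axis1 \<theta>) + norm ((axis2 \<theta> \<bullet> x) *\<^sub>R axis2 \<theta>)"
      by (subst axis_expansion[of x \<theta>]) (rule norm_triangle_ineq)
    also have "\<dots> = \<bar>axis1 \<theta> \<bullet> x\<bar> + \<bar>axis2 \<theta> \<bullet> x\<bar>"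
      by (simp add: norm_eq_sqrt_inner[of "axis1 \<theta>"] norm_eq_sqrt_inner[of "axis2 \<theta>"])
    finally show ?thesis using 1 2 by simp
  qed
  then have "bounded (biconvex_hull \<theta> T)" by (auto simp: bounded_iff)
  then show ?thesis using closed_biconvex_hull by (simp add: compact_eq_bounded_closed)
qed

text \<open>Around a missing point \<open>x\<close>, a quadrant whose boundary avoids
  \<open>T\<close> separates \<open>T\<close> into an inside and an outside part. Connectedness
  leaves only one of them, so either this closed quadrant or the opposite one misses
  \<open>T\<close>, which expels \<open>x\<close> from the hull.\<close>

lemma biconvex_hull_eq_self:
  assumes "compact T" "connected T" "biconvex \<theta> T"
  shows "biconvex_hull \<theta> T = T"
proof (intro equalityI subset_biconvex_hull subsetI)
  fix x assume x: "x \<in> biconvex_hull \<theta> T"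
  show "x \<in> T"
  proof (rule ccontr)
    assume nx: "x \<notin> T"
    \<comment> \<open>On each axis through x, convexity confines T to one side of x, so a closed quadrant
      with vertex x has a boundary missing T.\<close>
    have side: "\<exists>s\<in>{-1, 1::real}. \<forall>z\<in>T. f \<bullet> (z - x) = 0 \<longrightarrow> s * (e \<bullet> (z - x)) < 0"
      if c: "convex_along e T" and ex: "\<And>z. z = (e \<bullet> z) *\<^sub>R e + (f \<bullet> z) *\<^sub>R f" for e f
    proof (rule ccontr)
      assume "\<not> ?thesis"
      then obtain z1 z2 where z: "z1 \<in> T" "z2 \<in> T" "f \<bullet> (z1 - x) = 0" "f \<bullet> (z2 - x) = 0"
          "e \<bullet> (z1 - x) \<le> 0" "e \<bullet> (z2 - x) \<ge> 0"
        by (auto simp: not_less)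
      have "z1 = x + (e \<bullet> (z1 - x)) *\<^sub>R e" "z2 = x + (e \<bullet> (z2 - x)) *\<^sub>R e"
        using ex[of "z1 - x"] ex[of "z2 - x"] z(3,4) by (simp_all add: algebra_simps)
      then have "x \<in> T"
        using c[unfolded convex_along_def, rule_format, OF z(5,6)] z(1,2) by simp
      then show False using nx by simp
    qed
    obtain s where s: "s \<in> {-1, 1::real}"
        "\<And>z. z \<in> T \<Longrightarrow> axis2 \<theta> \<bullet> (z - x) = 0 \<Longrightarrow> s * (axis1 \<theta> \<bullet> (z - x)) < 0"
      using side[of "axis1 \<theta>" "axis2 \<theta>"] assms(3) axis_expansion
      unfolding biconvex_iff by blast
    have "z = (axis2 \<theta> \<bullet> z) *\<^sub>R axis2 \<theta> + (axis1 \<theta> \<bullet> z) *\<^sub>R axis1 \<theta>" for z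
      using axis_expansion[of z \<theta>] by (simp add: add.commute)
    then obtain t where t: "t \<in> {-1, 1::real}"
        "\<And>z. z \<in> T \<Longrightarrow> axis1 \<theta> \<bullet> (z - x) = 0 \<Longrightarrow> t * (axis2 \<theta> \<bullet> (z - x)) < 0"
      using side[of "axis2 \<theta>" "axis1 \<theta>"] assms(3) unfolding biconvex_iff by blast
    let ?f = "\<lambda>z. s * (axis1 \<theta> \<bullet> (z - x))" and ?g = "\<lambda>z. t * (axis2 \<theta> \<bullet> (z - x))"
    \<comment> \<open>The open quadrant and the complement of the closed one; together they omit
      only the boundary.\<close>
    let ?U = "{z. 0 < ?f z \<and> 0 < ?g z}" and ?V = "{z. ?f z < 0 \<or> ?g z < 0}"
    have "open ?U" "open ?V"
      by (intro open_Collect_conj open_Collect_disj open_Collect_less continuous_intros)+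
    moreover have "T \<subseteq> ?U \<union> ?V"
    proof
      fix z assume z: "z \<in> T"
      show "z \<in> ?U \<union> ?V"
      proof (rule ccontr)
        assume "z \<notin> ?U \<union> ?V"
        then have "?f z = 0 \<and> ?g z \<ge> 0 \<or> ?g z = 0 \<and> ?f z \<ge> 0" by auto
        then show False using s t z by (smt (verit, best) insert_iff mult_eq_0_iff singletonD)
      qed
    qed
    moreover have "?U \<inter> ?V \<inter> T = {}" by auto
    ultimately have "?U \<inter> T = {} \<or> ?V \<inter> T = {}"
      by (intro connectedD[OF assms(2)])
    then consider "?U \<inter> T = {}" | "?V \<inter> T = {}" by blast
    then have "x \<notin> biconvex_hull \<theta> T"
    proof cases
      case 1
      show ?thesis
        by (rule notin_biconvex_hullI[OF assms(1) s(1) t(1)])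
          (use 1 \<open>T \<subseteq> ?U \<union> ?V\<close> in blast)
    next
      case 2
      show ?thesis
      proof (rule notin_biconvex_hullI[OF assms(1), of "-s" "-t"])
        fix z assume "z \<in> T"
        then have "z \<in> ?U" using 2 \<open>T \<subseteq> ?U \<union> ?V\<close> by blast
        then show "- s * (axis1 \<theta> \<bullet> (z - x)) < 0 \<or> - t * (axis2 \<theta> \<bullet> (z - x)) < 0" by simp
      qed (use s t in auto)
    qed
    then show False using x by simp
  qed
qed

section \<open>Biconvexity from a null difference\<close>

text \<open>If \<open>x\<close> lies in a gap of \<open>T\<close> on a line parallel to \<open>e\<close>, connectedness makes \<open>T\<close> pass above
  or below \<open>x\<close> over every nearby point of that line. So \<open>H\<close> contains one of two mirror
  images of every point of a small box, all outside \<open>T\<close>.\<close>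
lemma convex_along_of_negligible_diff:
  fixes e f :: "real^2"
  assumes "closed T" "connected T" "T \<subseteq> H" "negligible (H - T)"
    and H: "convex_along e H" "convex_along f H"
    and on: "e \<bullet> e = 1" "f \<bullet> f = 1" "e \<bullet> f = 0"
    and ex: "\<And>z. z = (e \<bullet> z) *\<^sub>R e + (f \<bullet> z) *\<^sub>R f"
  shows "convex_along e T"
  unfolding convex_along_def
proof (intro allI impI, rule ccontr)
  fix x a b
  assume ab: "a \<le> 0" "0 \<le> b" and m: "x + a *\<^sub>R e \<in> T" "x + b *\<^sub>R e \<in> T" and nx: "x \<notin> T"
  have fe: "f \<bullet> e = 0" using on(3) by (simp add: inner_commute)
  have "open (- T)" using assms(1) by (simp add: open_Compl)
  then obtain r where r: "r > 0" "ball x r \<subseteq> - T" using nx by (auto simp: open_contains_ball)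
  have norm_sq: "(norm (u *\<^sub>R e + w *\<^sub>R f))\<^sup>2 = u\<^sup>2 + w\<^sup>2" for u w
    by (simp add: power2_norm_eq_inner inner_add_left inner_add_right on fe
        power2_eq_square[of u] power2_eq_square[of w])
  have out: "r\<^sup>2 \<le> u\<^sup>2 + w\<^sup>2" if "x + u *\<^sub>R e + w *\<^sub>R f \<in> T" for u w
  proof (rule ccontr)
    assume "\<not> r\<^sup>2 \<le> u\<^sup>2 + w\<^sup>2"
    then have "(norm (u *\<^sub>R e + w *\<^sub>R f))\<^sup>2 < r\<^sup>2" by (simp add: norm_sq)
    then have "norm (u *\<^sub>R e + w *\<^sub>R f) < r" using r(1) by (simp add: power_less_imp_less_base)
    then have "x + (u *\<^sub>R e + w *\<^sub>R f) \<in> ball x r"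
      by (simp only: mem_ball dist_norm norm_minus_commute[of x] add_diff_cancel_left')
    then show False using r(2) that by (auto simp: add.assoc)
  qed
  \<comment> \<open>With \<open>w = 0\<close>, \<open>out\<close> puts both end points outside the
    ball, so every abscissa of size below \<open>r/2\<close> lies between theirs.\<close>
  have ra: "a \<le> - r" "r \<le> b"
    using out[of a 0] out[of b 0] m ab r(1) abs_le_square_iff[of r a] abs_le_square_iff[of r b]
    by auto
  \<comment> \<open>\<open>?refl\<close> is the reflection in the line through \<open>x\<close>
    parallel to \<open>e\<close>, and \<open>?B\<close> is a box on one side of that line.
    Coordinates below \<open>r/2\<close> keep the box and its mirror image inside the ball, as
    \<open>(r/2)\<^sup>2 + (r/2)\<^sup>2 < r\<^sup>2\<close>.\<close>
  let ?refl = "\<lambda>y. y - (2 * (f \<bullet> (y - x))) *\<^sub>R f"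
  let ?B = "{y. - (r/2) < e \<bullet> (y - x) \<and> e \<bullet> (y - x) < r/2 \<and> 0 < f \<bullet> (y - x) \<and> f \<bullet> (y - x) < r/2}"
  have "y \<in> (H - T) \<union> ?refl ` (H - T)" if y: "y \<in> ?B" for y
  proof -
    define u where "u = e \<bullet> (y - x)"
    define v where "v = f \<bullet> (y - x)"
    have bounds: "\<bar>u\<bar> < r/2" "0 < v" "v < r/2" using y by (auto simp: u_def v_def)
    have au: "a \<le> u" "u \<le> b" using ra bounds(1) by linarith+
    have y_eq: "y = x + u *\<^sub>R e + v *\<^sub>R f"
      using ex[of "y - x"] by (simp add: u_def v_def algebra_simps)
    \<comment> \<open>The projection of the connected set \<open>T\<close> to the direction
      \<open>e\<close> is an interval containing \<open>a\<close> and \<open>b\<close>, so some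
      \<open>z\<close> in \<open>T\<close> has the same abscissa as \<open>y\<close>.\<close>
    have "connected ((\<lambda>z. e \<bullet> (z - x)) ` T)"
      by (intro connected_continuous_image continuous_intros assms(2))
    moreover have "a \<in> (\<lambda>z. e \<bullet> (z - x)) ` T" "b \<in> (\<lambda>z. e \<bullet> (z - x)) ` T"
      using m by (force simp: on)+
    ultimately have "u \<in> (\<lambda>z. e \<bullet> (z - x)) ` T"
      using connectedD_interval[of _ a b u] au by simp
    then obtain z where z: "z \<in> T" "u = e \<bullet> (z - x)" by auto
    define w where "w = f \<bullet> (z - x)"
    have z_eq: "z = x + u *\<^sub>R e + w *\<^sub>R f"
      using ex[of "z - x"] by (simp add: z(2) w_def algebra_simps)
    have zH: "x + u *\<^sub>R e + w *\<^sub>R f \<in> H"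
      using assms(3) z(1) unfolding z_eq[symmetric] by blast
    have line: "x + u *\<^sub>R e \<in> H"
      using H(1)[unfolded convex_along_def, rule_format, of "a - u" "b - u" "x + u *\<^sub>R e"]
        m assms(3) au by (simp add: subset_iff algebra_simps)
    have u2: "u\<^sup>2 < (r/2)\<^sup>2" using bounds(1) r(1) by (simp add: abs_square_less_1 power2_strict_mono)
    have v2: "v\<^sup>2 < (r/2)\<^sup>2" using bounds r(1) by (simp add: power_strict_mono)
    have r4: "(r/2)\<^sup>2 = r\<^sup>2 / 4" by (simp add: power_divide)
    have nT: "x + u *\<^sub>R e + v *\<^sub>R f \<notin> T" "x + u *\<^sub>R e + (- v) *\<^sub>R f \<notin> T"
      using out[of u v] out[of u "- v"] u2 v2 r4 zero_le_power2[of r]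
      unfolding power2_minus by argo+
    have w2: "r\<^sup>2 \<le> u\<^sup>2 + w\<^sup>2" using z(1) by (intro out) (simp only: z_eq[symmetric])
    then have "(r/2)\<^sup>2 < w\<^sup>2" using u2 r4 zero_le_power2[of r] by linarith
    then have w: "r/2 < \<bar>w\<bar>" using power_less_imp_less_base[of "r/2" 2 "\<bar>w\<bar>"] by simp
    \<comment> \<open>\<open>z\<close> lies beyond the box, above or below. Accordingly
      \<open>y\<close> or its mirror image is between the foot \<open>x + u *\<^sub>R e\<close> and
      \<open>z\<close>, hence in \<open>H\<close> by convexity along \<open>f\<close>.\<close>
    show ?thesis
    proof (cases "w \<ge> 0")
      case True
      have "y \<in> H"
        using H(2)[unfolded convex_along_def, rule_format, of "- v" "w - v" y]
          line zH w bounds True by (simp add: y_eq algebra_simps)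
      then show ?thesis using nT y_eq by simp
    next
      case False
      have "x + u *\<^sub>R e + (- v) *\<^sub>R f \<in> H"
        using H(2)[unfolded convex_along_def, rule_format, of "w + v" v "x + u *\<^sub>R e + (- v) *\<^sub>R f"]
          line zH w bounds False by (simp add: algebra_simps)
      moreover have "y = ?refl (x + u *\<^sub>R e + (- v) *\<^sub>R f)"
        by (simp add: y_eq on fe algebra_simps)
          (simp add: scaleR_2 flip: scaleR_scaleR)
      ultimately show ?thesis using nT by blast
    qed
  qed
  then have "?B \<subseteq> (H - T) \<union> ?refl ` (H - T)" by blast
  moreover have "negligible (?refl ` (H - T))"
    by (rule negligible_differentiable_image_negligible)
      (auto simp: assms(4) differentiable_on_def
        intro!: differentiable_diff differentiable_scaleR differentiable_mult)
  ultimately have "negligible ?B"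
    using assms(4) negligible_Un negligible_subset by blast
  moreover have "open ?B"
    by (intro open_Collect_conj open_Collect_less continuous_intros)
  moreover have "x + (r/4) *\<^sub>R f \<in> ?B" using r(1) by (simp add: on)
  ultimately show False using open_not_negligible by blast
qed

lemma biconvex_of_negligible_hull_diff:
  assumes "closed T" "connected T" "negligible (biconvex_hull \<theta> T - T)"
  shows "biconvex \<theta> T"
proof -
  have ex: "z = (axis2 \<theta> \<bullet> z) *\<^sub>R axis2 \<theta> + (axis1 \<theta> \<bullet> z) *\<^sub>R axis1 \<theta>" for z
    using axis_expansion[of z \<theta>] by (simp add: add.commute)
  note H = biconvex_biconvex_hull[of \<theta> T, unfolded biconvex_iff]
  have "convex_along (axis1 \<theta>) T"
    by (rule convex_along_of_negligible_diff[where f = "axis2 \<theta>",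
          OF assms(1,2) subset_biconvex_hull assms(3)])
      (rule axis_expansion | simp add: H)+
  moreover have "convex_along (axis2 \<theta>) T"
    by (rule convex_along_of_negligible_diff[where f = "axis1 \<theta>",
          OF assms(1,2) subset_biconvex_hull assms(3)])
      (rule ex | simp add: H)+
  ultimately show ?thesis by (simp add: biconvex_iff)
qed

section \<open>Connectedness from the frontier\<close>

text \<open>If \<open>T\<close> were the disjoint union of two nonempty closed pieces, their
  frontiers would be nonempty, disjoint and together the frontier of \<open>T\<close>, disconnecting
  it.\<close>

lemma connected_of_connected_frontier:
  fixes T :: "'a::{real_normed_vector, perfect_space, heine_borel} set"
  assumes "compact T" "connected (frontier T)"
  shows "connected T"
proof (rule ccontr)
  assume "\<not> connected T"
  then obtain U V where UV: "closed U" "closed V" "U \<noteq> {}" "V \<noteq> {}" "U \<union> V = T" "U \<inter> V = {}"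
    using connected_closed_set[OF compact_imp_closed[OF assms(1)]] by metis
  have "T \<inter> U = U" "T \<inter> V = V" using UV(5) by blast+
  then have c: "compact U" "compact V"
    using compact_Int_closed[OF assms(1) UV(1)] compact_Int_closed[OF assms(1) UV(2)]
    by simp_all
  have fr: "frontier C \<noteq> {}" if "compact C" "C \<noteq> {}" for C :: "'a set"
    using that frontier_not_empty[of C] not_compact_UNIV by metis
  have int: "frontier U \<subseteq> frontier T" "frontier V \<subseteq> frontier T"
  proof -
    have *: "frontier C \<subseteq> frontier T" if "closed C" "closed D" "C \<union> D = T" "C \<inter> D = {}" for C D
    proof
      fix x assume x: "x \<in> frontier C"
      have xC: "x \<in> C" "x \<notin> interior C" using x that(1) by (auto simp: frontier_def)
      \<comment> \<open>This set is open because \<open>D\<close> is closed, so a point of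
        \<open>C\<close> interior to \<open>T\<close> is interior to \<open>C\<close>.\<close>
      have "interior T - D \<subseteq> interior C"
        by (rule interior_maximal) (use that interior_subset[of T] in auto)
      then have "x \<notin> interior T" using xC that(4) by blast
      then show "x \<in> frontier T"
        using xC(1) that(3) closure_subset[of T] by (auto simp: frontier_def)
    qed
    show "frontier U \<subseteq> frontier T" "frontier V \<subseteq> frontier T"
      using *[of U V] *[of V U] UV by auto
  qed
  have "frontier T \<subseteq> frontier U \<union> frontier V"
    using UV(5) frontier_Un_subset by blast
  moreover have "frontier U \<inter> frontier V = {}"
    using UV(1,2,6) frontier_subset_closed by blast
  ultimately have "frontier U \<inter> frontier T = {} \<or> frontier V \<inter> frontier T = {}"
    by (intro connected_closedD[OF assms(2)]) auto
  then show False using fr[OF c(1) UV(3)] fr[OF c(2) UV(4)] int by blast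
qed


section \<open>Limits of hulls and of their areas\<close>

text \<open>Interiority leaves room inside the hull for some \<open>y\<close> in each open quadrant
  with vertex \<open>x\<close>. That quadrant then meets \<open>T\<close>, so it contains a point
  \<open>z\<close> of \<open>D\<close>. The strict inequalities for \<open>z\<close> persist as
  \<open>u k\<close> approaches \<open>\<theta>\<close>, and \<open>z\<close> eventually belongs to
  \<open>E k\<close>.\<close>

lemma eventually_mem_biconvex_hull:
  assumes x: "x \<in> interior (biconvex_hull \<theta> T)"
    and lim: "(u \<longlongrightarrow> \<theta>) F"
    and mono: "\<And>z. z \<in> D \<Longrightarrow> eventually (\<lambda>k. z \<in> E k) F"
    and dense: "T \<subseteq> closure D"
  shows "eventually (\<lambda>k. x \<in> biconvex_hull (u k) (E k)) F"
proof -
  have "eventually (\<lambda>k. frame_quadrant (u k) s t x \<inter> E k \<noteq> {}) F"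
    if st: "s \<in> {-1, 1}" "t \<in> {-1, 1}" for s t
  proof -
    have sq: "s * s = 1" "t * t = 1" using st by auto
    obtain r where r: "r > 0" "ball x r \<subseteq> biconvex_hull \<theta> T"
      using x by (auto simp: mem_interior)
    define d where "d = s *\<^sub>R axis1 \<theta> + t *\<^sub>R axis2 \<theta>"
    \<comment> \<open>The scale gives a step shorter than \<open>r\<close>; the \<open>+ 1\<close>
      keeps the denominator positive without computing \<open>norm d\<close>.\<close>
    define y where "y = x + (r / (2 * (norm d + 1))) *\<^sub>R d"
    have c: "r / (2 * (norm d + 1)) > 0" using r(1) by (simp add: add_nonneg_pos)
    have "norm d * r < r * (2 * (norm d + 1))"
      using r(1) by (simp add: mult_less_cancel_left algebra_simps) (smt (verit) mult_nonneg_nonneg norm_ge_zero)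
    then have "dist x y < r"
      using r(1) by (simp add: y_def dist_norm pos_divide_less_eq add_nonneg_pos mult.commute)
    then have yH: "y \<in> biconvex_hull \<theta> T" using r(2) by auto
    have "s * (axis1 \<theta> \<bullet> (y - x)) = (r / (2 * (norm d + 1))) * (s * s)"
      "t * (axis2 \<theta> \<bullet> (y - x)) = (r / (2 * (norm d + 1))) * (t * t)"
      by (simp_all add: y_def d_def inner_add_right)
    then have "y \<in> frame_quadrant \<theta> s t x"
      using c by (simp add: frame_quadrant_def sq)
    then have "frame_quadrant \<theta> s t x \<inter> T \<noteq> {}"
      using yH st unfolding mem_biconvex_hull by blast
    then have "frame_quadrant \<theta> s t x \<inter> closure D \<noteq> {}" using dense by blast
    then obtain z where z: "z \<in> D" "z \<in> frame_quadrant \<theta> s t x"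
      using open_Int_closure_eq_empty[OF open_frame_quadrant] by blast
    have "\<forall>i. ((\<lambda>k. axis1 (u k) $ i) \<longlongrightarrow> axis1 \<theta> $ i) F"
      "\<forall>i. ((\<lambda>k. axis2 (u k) $ i) \<longlongrightarrow> axis2 \<theta> $ i) F"
      using isCont_tendsto_compose[OF isCont_cos lim] isCont_tendsto_compose[OF isCont_sin lim]
      by (simp_all add: forall_2 axis1_def axis2_def tendsto_minus)
    then have a1: "((\<lambda>k. axis1 (u k)) \<longlongrightarrow> axis1 \<theta>) F"
      and a2: "((\<lambda>k. axis2 (u k)) \<longlongrightarrow> axis2 \<theta>) F"
      by (simp_all add: vec_tendstoI)
    have "eventually (\<lambda>k. 0 < s * (axis1 (u k) \<bullet> (z - x))) F"
      using z(2) by (intro order_tendstoD(1)[OF tendsto_mult_left[OF tendsto_inner[OF a1 tendsto_const]]])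
        (simp add: frame_quadrant_def)
    moreover have "eventually (\<lambda>k. 0 < t * (axis2 (u k) \<bullet> (z - x))) F"
      using z(2) by (intro order_tendstoD(1)[OF tendsto_mult_left[OF tendsto_inner[OF a2 tendsto_const]]])
        (simp add: frame_quadrant_def)
    ultimately show ?thesis using mono[OF z(1)]
      by eventually_elim (auto simp: frame_quadrant_def)
  qed
  then have "eventually (\<lambda>k. \<forall>s\<in>{-1, 1}. \<forall>t\<in>{-1, 1}.
      frame_quadrant (u k) s t x \<inter> E k \<noteq> {}) F"
    by (simp add: eventually_conj_iff)
  then show ?thesis
  proof eventually_elim
    case (elim k)
    \<comment> \<open>Quadrants with vertex \<open>x\<close> are enough: any quadrant containing
      \<open>x\<close> contains the one of the same signs with vertex \<open>x\<close>.\<close>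
    have "frame_quadrant (u k) s t x \<subseteq> frame_quadrant (u k) s t y"
      if "x \<in> frame_quadrant (u k) s t y" for s t y
      using that by (auto simp: frame_quadrant_def inner_diff_right algebra_simps)
    then show ?case using elim unfolding mem_biconvex_hull by fast
  qed
qed

text \<open>Multiplying the convergent quotient by \<open>2 * \<epsilon>\<close> shows that the area
  of the thickening tends to zero, and this area bounds that of \<open>C\<close>.\<close>

lemma negligible_of_thickening_tendsto:
  fixes C :: "(real^2) set"
  assumes "compact C"
    and lim: "((\<lambda>\<epsilon>. measure lebesgue (closed_thickening C \<epsilon>) / (2 * \<epsilon>)) \<longlongrightarrow> l) (at_right 0)"
  shows "negligible C"
proof -
  have "((\<lambda>\<epsilon>. measure lebesgue (closed_thickening C \<epsilon>) / (2 * \<epsilon>) * (2 * \<epsilon>)) \<longlongrightarrow> l * (2 * 0)) (at_right 0)"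
    by (intro tendsto_mult lim tendsto_const tendsto_ident_at)
  moreover have "eventually (\<lambda>\<epsilon>. measure lebesgue C
      \<le> measure lebesgue (closed_thickening C \<epsilon>) / (2 * \<epsilon>) * (2 * \<epsilon>)) (at_right (0::real))"
    unfolding eventually_at_right_field
  proof (intro exI[of _ 1] conjI allI impI)
    fix \<epsilon> :: real assume "0 < \<epsilon>" "\<epsilon> < 1"
    \<comment> \<open>The thickening is a Minkowski sum with a closed ball, hence compact and
      measurable.\<close>
    have "closed_thickening C \<epsilon> = {x + y | x y. x \<in> C \<and> y \<in> cball 0 \<epsilon>}" (is "_ = ?R")
    proof (intro equalityI subsetI)
      fix z assume "z \<in> closed_thickening C \<epsilon>"
      then obtain x where "x \<in> C" "dist x z \<le> \<epsilon>" by (auto simp: closed_thickening_def)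
      then show "z \<in> ?R"
        by (intro CollectI exI[of _ x] exI[of _ "z - x"]) (simp add: dist_norm norm_minus_commute)
    next
      fix z assume "z \<in> ?R"
      then show "z \<in> closed_thickening C \<epsilon>"
        by (auto simp: closed_thickening_def dist_norm intro: bexI[rotated])
    qed
    then have "compact (closed_thickening C \<epsilon>)"
      using compact_sums[OF assms(1) compact_cball[of 0 \<epsilon>]] by simp
    then have "closed_thickening C \<epsilon> \<in> lmeasurable" by (rule lmeasurable_compact)
    moreover have "C \<subseteq> closed_thickening C \<epsilon>"
      using \<open>0 < \<epsilon>\<close> by (force simp: closed_thickening_def)
    ultimately have "measure lebesgue C \<le> measure lebesgue (closed_thickening C \<epsilon>)"
      using lmeasurable_compact[OF assms(1)] by (intro measure_mono_fmeasurable) auto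
    then show "measure lebesgue C
      \<le> measure lebesgue (closed_thickening C \<epsilon>) / (2 * \<epsilon>) * (2 * \<epsilon>)"
      using \<open>0 < \<epsilon>\<close> by simp
  qed simp
  ultimately have "measure lebesgue C \<le> l * (2 * 0)"
    by (rule tendsto_lowerbound) simp
  then have "measure lebesgue C = 0" by (simp add: measure_le_0_iff)
  then show ?thesis
    using lmeasurable_compact[OF assms(1)] by (simp add: negligible_iff_measure)
qed

text \<open>\<open>I\<close> lies in the lower limit of the sets \<open>E k\<close>. The tail
  intersections \<open>G m\<close> increase to it, each inside some \<open>E k\<close> of measure at
  most \<open>c\<close>, and continuity from below passes the bound to their union.\<close>

lemma emeasure_le_of_eventually_mem:
  fixes E :: "nat \<Rightarrow> 'a set"
  assumes "I \<in> sets M" "\<And>k. E k \<in> sets M"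
    and ev: "\<And>x. x \<in> I \<Longrightarrow> eventually (\<lambda>k. x \<in> E k) sequentially"
    and le: "eventually (\<lambda>k. emeasure M (E k) \<le> c) sequentially"
  shows "emeasure M I \<le> c"
proof -
  define G where "G = (\<lambda>m. \<Inter>k\<in>{m..}. E k)"
  have G: "range G \<subseteq> sets M" using assms(2) by (auto simp: G_def intro!: sets.countable_INT')
  have "I \<subseteq> (\<Union>m. G m)"
    using ev by (fastforce simp: G_def eventually_sequentially)
  then have "emeasure M I \<le> emeasure M (\<Union>m. G m)"
    using G by (intro emeasure_mono) auto
  also have "\<dots> = (SUP m. emeasure M (G m))"
    using G by (intro SUP_emeasure_incseq[symmetric]) (force simp: G_def incseq_def)+
  also have "\<dots> \<le> c"
  proof (rule SUP_least)
    fix m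
    obtain n where n: "\<And>k. k \<ge> n \<Longrightarrow> emeasure M (E k) \<le> c"
      using le by (auto simp: eventually_sequentially)
    have "emeasure M (G m) \<le> emeasure M (E (max m n))"
      using assms(2) by (intro emeasure_mono) (auto simp: G_def)
    also have "\<dots> \<le> c" by (rule n) simp
    finally show "emeasure M (G m) \<le> c" .
  qed
  finally show ?thesis .
qed

section \<open>Almost sure density of the sample\<close>

text \<open>With \<open>q < 1\<close> the mass of the complement of \<open>B\<close>, independence
  gives probability \<open>q ^ n\<close> that the first \<open>n\<close> variables all miss
  \<open>B\<close>, and this tends to zero.\<close>

lemma (in prob_space) AE_ex_mem_of_indep:
  assumes ind: "indep_vars (\<lambda>_. N) X {1::nat..}"
    and dist: "\<And>i. i \<ge> 1 \<Longrightarrow> distr M N (X i) = P"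
    and B: "B \<in> sets N" and pos: "measure P B > 0"
  shows "AE \<omega> in M. \<exists>i\<ge>1. X i \<omega> \<in> B"
proof -
  have X: "X i \<in> measurable M N" if "i \<ge> 1" for i
    using ind that by (auto simp: indep_vars_def)
  have setsP: "sets P = sets N" and P: "prob_space P"
    using dist[of 1] prob_space_distr[OF X[of 1]] by auto
  interpret P: prob_space P by (rule P)
  define q where "q = measure P (space P - B)"
  have q: "0 \<le> q" "q < 1"
    using pos P.prob_compl[of B] B setsP by (auto simp: q_def)
  let ?F = "{\<omega>\<in>space M. \<forall>i\<ge>1. X i \<omega> \<notin> B}"
  have meas: "X i -` (space N - B) \<inter> space M \<in> sets M" if "i \<ge> 1" for i
    using measurable_sets[OF X[OF that]] B by blast
  have Feq: "?F = (\<Inter>i\<in>{1..}. X i -` (space N - B) \<inter> space M)"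
    using X by (auto dest: measurable_space)
  have F: "?F \<in> sets M"
    unfolding Feq by (intro sets.countable_INT') (use meas in auto)
  have pr: "prob (X i -` (space N - B) \<inter> space M) = q" if "i \<ge> 1" for i
  proof -
    have "space N = space P" using dist[OF that] by (auto simp flip: dist[OF that])
    then show ?thesis
      using measure_distr[OF X[OF that], of "space N - B"] sets.compl_sets[OF B] dist[OF that]
      by (simp add: q_def)
  qed
  \<comment> \<open>For \<open>n = 0\<close> the intersection below would be the whole type instead
    of \<open>space M\<close>.\<close>
  have le_power: "prob ?F \<le> q ^ n" if "n \<ge> 1" for n
  proof -
    have "prob ?F \<le> prob (\<Inter>i\<in>{1..n}. X i -` (space N - B) \<inter> space M)"
      unfolding Feq using that meas
      by (intro finite_measure_mono INF_superset_mono sets.finite_INT) auto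
    also have "\<dots> = (\<Prod>i\<in>{1..n}. prob (X i -` (space N - B) \<inter> space M))"
      using that B by (intro indep_varsD[OF ind]) auto
    also have "\<dots> = q ^ n" using pr by simp
    finally show ?thesis .
  qed
  have "prob ?F \<le> 0"
    by (rule LIMSEQ_le_const[OF LIMSEQ_realpow_zero[OF q]]) (use le_power in blast)
  then have "prob ?F = 0" by (simp only: measure_le_0_iff)
  then have "?F \<in> null_sets M" 
    using F by (intro null_setsI) (simp_all only: emeasure_eq_measure ennreal_0)
  then show ?thesis by (rule AE_I') blast
qed

text \<open>Each \<open>X i\<close> lies in \<open>T\<close> almost surely because \<open>T\<close>
  has mass one. A basic open set that meets \<open>T\<close> has positive mass, since otherwise its
  complement would be a closed set of mass one not containing \<open>T\<close>; so it is hit almost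
  surely, and a countable basis leaves only countably many null events.\<close>

lemma (in prob_space) AE_sample_dense_in_support:
  assumes ind: "indep_vars (\<lambda>_. borel) X {1::nat..}"
    and dist: "\<And>i. i \<ge> 1 \<Longrightarrow> distr M borel (X i) = P"
    and supp: "is_support P T"
  shows "AE \<omega> in M. (\<lambda>i. X i \<omega>) ` {1..} \<subseteq> T \<and> T \<subseteq> closure ((\<lambda>i. X i \<omega>) ` {1..})"
proof -
  have X: "X i \<in> measurable M borel" if "i \<ge> 1" for i
    using ind that by (auto simp: indep_vars_def)
  have setsP: "sets P = sets borel" and spP: "space P = UNIV" and P: "prob_space P"
    using dist[of 1] prob_space_distr[OF X[of 1]] space_distr[of M borel "X 1"] by auto
  interpret P: prob_space P by (rule P)
  have T: "closed T" "measure P T = 1"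
    and least: "\<And>C. closed C \<Longrightarrow> measure P C = 1 \<Longrightarrow> T \<subseteq> C"
    using supp by (auto simp: is_support_def)
  have "AE \<omega> in M. X i \<omega> \<in> T" if "i \<ge> 1" for i
  proof -
    have "prob (X i -` T \<inter> space M) = 1"
      using measure_distr[OF X[OF that], of T] T dist[OF that] by simp
    then have "AE \<omega> in M. \<omega> \<in> X i -` T \<inter> space M"
      by (rule AE_prob_1)
    then show ?thesis by auto
  qed
  then have in_T: "AE \<omega> in M. \<forall>i\<in>{1..}. X i \<omega> \<in> T"
    by (subst AE_ball_countable) auto
  obtain \<B> :: "(real^2) set set" where \<B>: "countable \<B>" "topological_basis \<B>"
    using ex_countable_basis by blast
  have "AE \<omega> in M. \<exists>i\<ge>1. X i \<omega> \<in> B" if "B \<in> \<B>" "B \<inter> T \<noteq> {}" for B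
  proof (rule AE_ex_mem_of_indep[OF ind dist])
    have "open B" using that(1) \<B>(2) by (rule topological_basis_open[rotated])
    then show B: "B \<in> sets borel" by simp
    have "measure P B \<noteq> 0"
    proof
      assume "measure P B = 0"
      then have "measure P (- B) = 1"
        using P.prob_compl[of B] B setsP spP by (simp add: Compl_eq_Diff_UNIV)
      then have "T \<subseteq> - B" using least \<open>open B\<close> by (simp add: closed_Compl)
      then show False using that(2) by blast
    qed
    then show "measure P B > 0" by (simp add: zero_less_measure_iff)
  qed auto
  then have "AE \<omega> in M. \<forall>B\<in>{B\<in>\<B>. B \<inter> T \<noteq> {}}. \<exists>i\<ge>1. X i \<omega> \<in> B"
    using \<B>(1) by (subst AE_ball_countable) auto
  with in_T show ?thesis
  proof eventually_elim
    case (elim \<omega>)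
    have "x \<in> closure ((\<lambda>i. X i \<omega>) ` {1..})" if "x \<in> T" for x
      unfolding closure_iff_nhds_not_empty
    proof (intro allI impI)
      fix A V assume "V \<subseteq> A" "open V" "x \<in> V"
      then obtain B where "B \<in> \<B>" "x \<in> B" "B \<subseteq> V"
        using topological_basisE[OF \<B>(2)] by metis
      then show "(\<lambda>i. X i \<omega>) ` {1..} \<inter> A \<noteq> {}" using elim(2) that \<open>V \<subseteq> A\<close> by blast
    qed
    then show ?case using elim(1) by auto
  qed
qed

section \<open>Consistency of the minimising angles\<close>

theorem theorem6:
  fixes S :: "(real^2) set"
    and L0 :: "real \<Rightarrow> real" and L :: real
    and M :: "'w measure" and P :: "(real^2) measure"
    and X :: "nat \<Rightarrow> 'w \<Rightarrow> real^2"
    and A :: "real set"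
    and \<Psi> :: "nat \<Rightarrow> 'w \<Rightarrow> real \<Rightarrow> real"
    and \<theta>hat :: "nat \<Rightarrow> 'w \<Rightarrow> real"
  assumes "compact S"
    and "path_connected (frontier S)"
    and "S = closure (interior S)"
    and "uniform_limit {0..pi/2}
           (\<lambda>\<epsilon> \<theta>. measure lebesgue (closed_thickening (frontier (biconvex_hull \<theta> S)) \<epsilon>) / (2 * \<epsilon>))
           L0 (at_right 0)"
    and "L > 0"
    and "\<forall>\<theta>\<in>{0..pi/2}. L0 \<theta> \<le> L"
    and "prob_space M"
    and "prob_space.indep_vars M (\<lambda>_. borel) X {1..}"
    and "\<forall>i\<ge>1. distr M borel (X i) = P"
    and "is_support P S"
    and "A = {\<theta>\<in>{0..pi/2}. biconvex \<theta> S}"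
    and "A \<noteq> {}"
    and "\<Psi> = (\<lambda>n \<omega> \<theta>. measure lebesgue (biconvex_hull \<theta> ((\<lambda>i. X i \<omega>) ` {1..n})))"
    and "\<forall>n\<ge>1. \<theta>hat n \<in> borel_measurable M"
    and "\<forall>n\<ge>1. \<forall>\<omega>\<in>space M. is_arg_min (\<Psi> n \<omega>) (\<lambda>\<theta>. \<theta> \<in> {0..pi/2}) (\<theta>hat n \<omega>)"
  shows "AE \<omega> in M. \<forall>a. seq_accumulation_point (\<lambda>n. \<theta>hat n \<omega>) a \<longrightarrow> a \<in> A"
proof -
  let ?H = "\<lambda>\<theta>. biconvex_hull \<theta> S"
  let ?sample = "\<lambda>n \<omega>. (\<lambda>i. X i \<omega>) ` {1..n}"
  interpret prob_space M by (rule assms(7))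
  have conn: "connected S"
    by (rule connected_of_connected_frontier[OF assms(1) path_connected_imp_connected[OF assms(2)]])
  obtain \<theta>0 where \<theta>0: "\<theta>0 \<in> {0..pi/2}" "biconvex \<theta>0 S" using assms(12) unfolding assms(11) by blast
  have H0: "?H \<theta>0 = S" by (rule biconvex_hull_eq_self[OF assms(1) conn \<theta>0(2)])
  \<comment> \<open>Uniform convergence gives a finite limit at each single angle, which makes the
    frontier null.\<close>
  have null: "negligible (frontier (?H \<theta>))" if "\<theta> \<in> {0..pi/2}" for \<theta>
    by (rule negligible_of_thickening_tendsto[OF compact_frontier[OF compact_biconvex_hull[OF assms(1)]]])
      (rule tendsto_uniform_limitI[OF assms(4) that])
  have "AE \<omega> in M. (\<lambda>i. X i \<omega>) ` {1..} \<subseteq> S \<and> S \<subseteq> closure ((\<lambda>i. X i \<omega>) ` {1..})"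
    using assms(8-10) by (intro AE_sample_dense_in_support) auto
  then show ?thesis
  proof (rule AE_mp, intro AE_I2 impI allI, elim conjE)
    fix \<omega> a
    assume \<omega>: "\<omega> \<in> space M" and sub: "(\<lambda>i. X i \<omega>) ` {1..} \<subseteq> S"
      and dense: "S \<subseteq> closure ((\<lambda>i. X i \<omega>) ` {1..})"
      and "seq_accumulation_point (\<lambda>n. \<theta>hat n \<omega>) a"
    then obtain r where r: "strict_mono r" and lim: "(\<lambda>k. \<theta>hat (r k) \<omega>) \<longlonglongrightarrow> a"
      by (auto simp: seq_accumulation_point_def o_def)
    \<comment> \<open>Ensures \<open>r k \<ge> 1\<close> for \<open>k \<ge> 1\<close>, the range
      where minimality is assumed, and lets \<open>r k\<close> reach the index of any sample
      point.\<close>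
    have rk: "k \<le> r k" for k using r by (rule strict_mono_imp_increasing)
    have argmin: "\<theta>hat n \<omega> \<in> {0..pi/2}" "\<Psi> n \<omega> (\<theta>hat n \<omega>) \<le> \<Psi> n \<omega> \<theta>0" if "n \<ge> 1" for n
      using assms(15) \<omega> that \<theta>0(1) unfolding is_arg_min_def by (meson not_less)+
    have a: "a \<in> {0..pi/2}"
    proof (rule Lim_in_closed_set[OF closed_atLeastAtMost _ _ lim])
      show "eventually (\<lambda>k. \<theta>hat (r k) \<omega> \<in> {0..pi/2}) sequentially"
        unfolding eventually_sequentially
        using argmin(1) rk le_trans by (intro exI[of _ 1]) blast
    qed simp
    define E where "E = (\<lambda>k. biconvex_hull (\<theta>hat (r k) \<omega>) (?sample (r k) \<omega>))"
    have lm: "biconvex_hull \<theta> (?sample n \<omega>) \<in> lmeasurable" for \<theta> n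
      by (intro lmeasurable_compact compact_biconvex_hull finite_imp_compact) simp
    have S: "S \<in> lmeasurable" "?H a \<in> lmeasurable"
      using assms(1) by (auto intro!: lmeasurable_compact compact_biconvex_hull)
    \<comment> \<open>Minimality compares the sample hull at the minimiser with the one at
      \<open>\<theta>0\<close>, which lies in \<open>?H \<theta>0 = S\<close> by
      monotonicity.\<close>
    have vol: "emeasure lebesgue (E k) \<le> emeasure lebesgue S" if "k \<ge> 1" for k
    proof -
      have "r k \<ge> 1" using rk[of k] that by simp
      then have "measure lebesgue (E k) \<le> measure lebesgue (biconvex_hull \<theta>0 (?sample (r k) \<omega>))"
        using argmin(2)[of "r k"] by (simp add: E_def assms(13))
      also have "\<dots> \<le> measure lebesgue S"
      proof (rule measure_mono_fmeasurable)
        show "biconvex_hull \<theta>0 (?sample (r k) \<omega>) \<subseteq> S"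
          using biconvex_hull_mono[of "?sample (r k) \<omega>" S \<theta>0] sub unfolding H0
          by fastforce
      qed (use lm S in auto)
      finally show ?thesis
        using lm S(1) by (simp add: E_def emeasure_eq_measure2 ennreal_leI)
    qed
    have "emeasure lebesgue (interior (?H a)) \<le> emeasure lebesgue S"
    proof (rule emeasure_le_of_eventually_mem)
      show "E k \<in> sets lebesgue" for k using lm by (auto simp: E_def)
      show "eventually (\<lambda>k. x \<in> E k) sequentially" if "x \<in> interior (?H a)" for x
        unfolding E_def
      proof (rule eventually_mem_biconvex_hull[OF that lim _ dense])
        fix z assume "z \<in> (\<lambda>i. X i \<omega>) ` {1..}"
        then obtain i where i: "i \<ge> 1" "z = X i \<omega>" by auto
        show "eventually (\<lambda>k. z \<in> ?sample (r k) \<omega>) sequentially"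
          unfolding eventually_sequentially
          using i by (intro exI[of _ i]) (auto intro!: imageI intro: order_trans[OF _ rk])
      qed
      show "eventually (\<lambda>k. emeasure lebesgue (E k) \<le> emeasure lebesgue S) sequentially"
        using vol by (auto simp: eventually_sequentially)
    qed simp
    then have "measure lebesgue (interior (?H a)) \<le> measure lebesgue S"
      using S(1) lmeasurable_interior[OF compact_imp_bounded[OF compact_biconvex_hull[OF assms(1)]], of a]
      by (simp only: emeasure_eq_measure2 ennreal_le_iff measure_nonneg)
    \<comment> \<open>The null frontier carries the bound from the interior to the whole
      hull.\<close>
    moreover have "measure lebesgue (interior (?H a)) = measure lebesgue (?H a)"
      using null[OF a] compact_biconvex_hull[OF assms(1)]
      by (intro measure_interior compact_imp_bounded)
    ultimately have "measure lebesgue (?H a - S) \<le> 0"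
      using S subset_biconvex_hull[of S a]
      by (subst measurable_measure_Diff) auto
    then have "negligible (?H a - S)"
      using S by (simp add: negligible_iff_measure fmeasurable.Diff measure_le_0_iff)
    then have "biconvex a S"
      using biconvex_of_negligible_hull_diff[OF compact_imp_closed[OF assms(1)] conn] by blast
    then show "a \<in> A" using a unfolding assms(11) by simp
  qed
qed

end
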